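(* Let $|\psi\rangle_{AB}=\sum_{j,k\in\{0,1\}}c_{jk}|jk\rangle_{AB}$ be a pure state (unit vector) of the two-qubit system $AB$, i.e. in $\mathbb{C}^2\otimes\mathbb{C}^2$. When the state satisfies the diagonal condition $c_{00}^*c_{01}+c_{10}^*c_{11}=0$, its Schmidt decomposition is given by $$|\psi\rangle_{AB}=\sqrt{|c_{00}|^2+|c_{10}|^2}\left(\frac{1}{\sqrt{|c_{00}|^2+|c_{10}|^2}}\begin{bmatrix}c_{00}\\c_{10}\end{bmatrix}\right)\otimes|0\rangle+\sqrt{|c_{01}|^2+|c_{11}|^2}\left(\frac{1}{\sqrt{|c_{01}|^2+|c_{11}|^2}}\begin{bmatrix}c_{01}\\c_{11}\end{bmatrix}\right)\otimes|1\rangle.$$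
   Context: $|0\rangle,|1\rangle$ is the standard basis of $\mathbb{C}^2$, $|jk\rangle_{AB}=|j\rangle_A\otimes|k\rangle_B$, column vectors are with respect to the standard basis, and $^*$ is complex conjugation. A Schmidt decomposition of a unit vector $|\psi\rangle\in\mathbb{C}^2\otimes\mathbb{C}^2$ is an expression $|\psi\rangle=\sum_j\lambda_j|u_j\rangle\otimes|v_j\rangle$ with $\lambda_j\ge 0$ (the Schmidt coefficients) and with $\{|u_j\rangle\}$, $\{|v_j\rangle\}$ orthonormal families in $\mathbb{C}^2$. *)

theory Defs
  imports "HOL-Analysis.Analysis"
begin

text \<open>
  The numeral type \<open>2\<close> has exactly the two elements \<open>0\<close> and \<open>1\<close> (with \<open>2 = 0\<close>), so it serves
  directly as the index set of the standard basis of \<open>complex ^ 2\<close>.  The tensor square of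
  \<open>complex ^ 2\<close> is modelled as \<open>complex ^ (2 \<times> 2)\<close>, with the Kronecker product as tensor
  product; the library norm on this space is the Hilbert space norm.
\<close>

definition ket :: "2 \<Rightarrow> complex ^ 2" where
  "ket j = axis j 1"

definition tensor :: "complex ^ 2 \<Rightarrow> complex ^ 2 \<Rightarrow> complex ^ (2 \<times> 2)"  (infixl "\<otimes>" 75) where
  "u \<otimes> v = (\<chi> p. u $ fst p * v $ snd p)"

text \<open>
  The library inner product on \<open>complex ^ 2\<close> is only the real part of the Hermitian one, hence
  too weak to express orthogonality over the complex numbers.
\<close>

definition cinner :: "complex ^ 2 \<Rightarrow> complex ^ 2 \<Rightarrow> complex" where
  "cinner u v = (\<Sum>i\<in>UNIV. cnj (u $ i) * v $ i)"

definition orthonormal_family :: "'i set \<Rightarrow> ('i \<Rightarrow> complex ^ 2) \<Rightarrow> bool" where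
  "orthonormal_family J u \<longleftrightarrow>
     (\<forall>i\<in>J. \<forall>j\<in>J. cinner (u i) (u j) = (if i = j then 1 else 0))"

definition schmidt_decomposition ::
  "'i set \<Rightarrow> ('i \<Rightarrow> real) \<Rightarrow> ('i \<Rightarrow> complex ^ 2) \<Rightarrow> ('i \<Rightarrow> complex ^ 2) \<Rightarrow> complex ^ (2 \<times> 2) \<Rightarrow> bool"
where
  "schmidt_decomposition J l u v \<psi> \<longleftrightarrow>
     finite J \<and> (\<forall>j\<in>J. 0 \<le> l j) \<and> orthonormal_family J u \<and> orthonormal_family J v \<and>
     \<psi> = (\<Sum>j\<in>J. complex_of_real (l j) *s (u j \<otimes> v j))"

end

theory Submission
  imports Defs
begin

text \<open>
  The column \<open>c\<^sub>k = (c\<^sub>0\<^sub>k, c\<^sub>1\<^sub>k)\<close> always gives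
  \<open>\<psi> = c\<^sub>0 \<otimes> |0\<rangle> + c\<^sub>1 \<otimes> |1\<rangle>\<close>, and the diagonal condition says that the two columns
  are orthogonal, so normalising the nonzero ones yields a Schmidt decomposition.  If a column
  vanishes, its coefficient is zero and the missing vector can be any unit vector orthogonal to
  the other one.
\<close>

lemma UNIV_2_eq: "(UNIV :: 2 set) = {0, 1}"
  using UNIV_2 by auto

lemma eq_0_or_1_2: "i = 0 \<or> i = 1" for i :: 2
  using UNIV_2_eq by auto

lemma forall_2_iff: "(\<forall>i::2. P i) \<longleftrightarrow> P 0 \<and> P 1"
  using eq_0_or_1_2 by metis

lemma sum_UNIV_2: "(\<Sum>i\<in>(UNIV :: 2 set). f i) = f 0 + f 1"
  by (simp add: UNIV_2_eq)

lemma cinner_2: "cinner u v = cnj (u $ 0) * v $ 0 + cnj (u $ 1) * v $ 1"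
  by (simp add: cinner_def sum_UNIV_2)

lemma cinner_commute: "cinner v u = cnj (cinner u v)"
  by (simp add: cinner_def mult.commute)

lemma cinner_ket: "cinner (ket i) (ket j) = (if i = j then 1 else 0)"
  using eq_0_or_1_2[of i] eq_0_or_1_2[of j] by (auto simp: cinner_2 ket_def axis_def)

lemma orthonormal_family_ket: "orthonormal_family J ket"
  by (simp add: orthonormal_family_def cinner_ket)

text \<open>Conjugate symmetry of \<open>cinner\<close> makes the two mixed conditions equivalent,
  so one of them suffices.\<close>

lemma orthonormal_family_UNIV_2:
  fixes u :: "2 \<Rightarrow> complex ^ 2"
  shows "orthonormal_family UNIV u \<longleftrightarrow>
     cinner (u 0) (u 0) = 1 \<and> cinner (u 1) (u 1) = 1 \<and> cinner (u 0) (u 1) = 0"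
  unfolding orthonormal_family_def ball_UNIV forall_2_iff
  by (auto simp: cinner_commute[of "u 1" "u 0"])

lemma ex_orthogonal_unit_vector:
  assumes "cinner w w = 1"
  obtains v where "cinner v v = 1" "cinner w v = 0"
proof
  \<comment> \<open>Swapping the entries of \<open>w\<close>, conjugating them and negating one
    preserves the norm, and makes the two terms of \<open>cinner w v\<close> cancel.\<close>
  define v :: "complex ^ 2" where "v = (\<chi> i. if i = 0 then - cnj (w $ 1) else cnj (w $ 0))"
  show "cinner v v = 1" "cinner w v = 0"
    using assms by (simp_all add: v_def cinner_2 algebra_simps)
qed

text \<open>Supplies the vectors missing at vanishing columns. Only a singleton \<open>J\<close>
  needs a construction: the other index receives a unit vector orthogonal to the given one.\<close>

lemma orthonormal_family_extend:
  fixes u :: "2 \<Rightarrow> complex ^ 2"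
  assumes "orthonormal_family J u"
  obtains u' where "\<And>k. k \<in> J \<Longrightarrow> u' k = u k" "orthonormal_family UNIV u'"
proof -
  have "J \<subseteq> {0, 1}"
    using UNIV_2_eq by blast
  then consider "J = UNIV" | "J = {}" | k where "J = {k}"
    unfolding UNIV_2_eq by blast
  then show thesis
  proof cases
    case 1
    then show thesis using assms that by blast
  next
    case 2
    then show thesis using that[of ket] orthonormal_family_ket by blast
  next
    case 3
    then have unit: "cinner (u k) (u k) = 1"
      using assms by (simp add: orthonormal_family_def)
    then obtain v where v: "cinner v v = 1" "cinner (u k) v = 0"
      by (rule ex_orthogonal_unit_vector)
    have "orthonormal_family UNIV (\<lambda>j. if j = k then u k else v)"
      using v unit cinner_commute[of v "u k"] eq_0_or_1_2[of k]
      by (auto simp: orthonormal_family_UNIV_2)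
    then show thesis
      by (rule that[rotated]) (simp add: 3)
  qed
qed

theorem proposition1:
  fixes c :: "2 \<Rightarrow> 2 \<Rightarrow> complex" and \<psi> :: "complex ^ (2 \<times> 2)"
  assumes "\<psi> = (\<Sum>j\<in>UNIV. \<Sum>k\<in>UNIV. c j k *s (ket j \<otimes> ket k))"
    and "norm \<psi> = 1"
    and "cnj (c 0 0) * c 0 1 + cnj (c 1 0) * c 1 1 = 0"
  shows "let l = (\<lambda>k. sqrt ((cmod (c 0 k))\<^sup>2 + (cmod (c 1 k))\<^sup>2));
             u = (\<lambda>k. complex_of_real (1 / l k) *s (\<chi> j. c j k))
         in \<psi> = complex_of_real (l 0) *s (u 0 \<otimes> ket 0) + complex_of_real (l 1) *s (u 1 \<otimes> ket 1)
          \<and> schmidt_decomposition {k. l k \<noteq> 0} l u ket \<psi>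
          \<and> (\<exists>u'. (\<forall>k. l k \<noteq> 0 \<longrightarrow> u' k = u k) \<and> schmidt_decomposition UNIV l u' ket \<psi>)"
proof -
  define l where "l = (\<lambda>k. sqrt ((cmod (c 0 k))\<^sup>2 + (cmod (c 1 k))\<^sup>2))"
  define u :: "2 \<Rightarrow> complex ^ 2" where "u = (\<lambda>k. complex_of_real (1 / l k) *s (\<chi> j. c j k))"
  have l_nonneg: "0 \<le> l k" for k
    by (simp add: l_def)
  \<comment> \<open>This covers \<open>l k = 0\<close> as well: a vanishing sum of squares forces
    the whole column to be zero.\<close>
  have c_eq: "complex_of_real (l k) * u k $ j = c j k" for j k
  proof (cases "l k = 0")
    case True
    then have "\<forall>j. c j k = 0"
      by (simp add: l_def forall_2_iff sum_power2_eq_zero_iff)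
    then show ?thesis using True by simp
  qed (simp add: u_def)
  \<comment> \<open>Values of \<open>v\<close> at indices with \<open>l k = 0\<close> are left free,
    because their coefficient removes them. The expansion thus serves both \<open>u\<close> and its
    orthonormal extension \<open>u'\<close>.\<close>
  have psi: "\<psi> = (\<Sum>k\<in>UNIV. complex_of_real (l k) *s (v k \<otimes> ket k))"
    if "\<And>k. l k \<noteq> 0 \<Longrightarrow> v k = u k" for v
  proof -
    have "complex_of_real (l k) * v k $ j = c j k" for j k
      using c_eq[of k j] that[of k] by (cases "l k = 0") auto
    then have "\<psi> $ (i, j) = (\<Sum>k\<in>UNIV. complex_of_real (l k) *s (v k \<otimes> ket k)) $ (i, j)" for i j
      using eq_0_or_1_2[of i] eq_0_or_1_2[of j]
      by (auto simp: assms(1) sum_UNIV_2 tensor_def ket_def axis_def simp flip: mult.assoc)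
    then show ?thesis
      by (simp add: vec_eq_iff)
  qed
  have on: "orthonormal_family {k. l k \<noteq> 0} u"
  proof -
    have "cinner (u k) (u k) = 1" if "l k \<noteq> 0" for k
    proof -
      have "cnj (c 0 k) * c 0 k + cnj (c 1 k) * c 1 k = complex_of_real ((l k)\<^sup>2)"
        by (simp add: l_def complex_norm_square mult.commute del: of_real_power)
      then show ?thesis
        using that
        by (simp add: u_def cinner_2 power2_eq_square flip: add_divide_distrib)
    qed
    moreover have "cinner (u 0) (u 1) = 0"
    proof -
      \<comment> \<open>The factors \<open>1 / l k\<close> are real, so they also leave the
        conjugated argument unchanged, and the diagonal condition remains. Since
        \<open>1 / 0 = 0\<close>, the identity holds for a zero column too.\<close>
      have "cinner (u 0) (u 1)
          = complex_of_real (1 / l 0 * (1 / l 1)) * (cnj (c 0 0) * c 0 1 + cnj (c 1 0) * c 1 1)"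
        by (simp add: u_def cinner_2 algebra_simps add_divide_distrib)
      then show ?thesis by (simp only: assms(3) mult_zero_right)
    qed
    ultimately have "\<forall>i j. l i \<noteq> 0 \<longrightarrow> l j \<noteq> 0 \<longrightarrow> cinner (u i) (u j) = (if i = j then 1 else 0)"
      by (simp add: forall_2_iff cinner_commute[of "u 1" "u 0"])
    then show ?thesis by (simp add: orthonormal_family_def)
  qed
  have "schmidt_decomposition {k. l k \<noteq> 0} l u ket \<psi>"
  proof -
    \<comment> \<open>Dropping the indices with \<open>l k = 0\<close> removes only zero
      summands.\<close>
    have "\<psi> = (\<Sum>k\<in>{k. l k \<noteq> 0}. complex_of_real (l k) *s (u k \<otimes> ket k))"
      by (subst psi[of u], simp, rule sum.mono_neutral_right) auto
    then show ?thesis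
      by (simp add: schmidt_decomposition_def l_nonneg on orthonormal_family_ket)
  qed
  \<comment> \<open>At a zero column \<open>u k\<close> is the zero vector, not a unit vector, so an
    orthonormal family over both indices requires replacing it.\<close>
  moreover obtain u' where u': "\<And>k. l k \<noteq> 0 \<Longrightarrow> u' k = u k" "orthonormal_family UNIV u'"
    using orthonormal_family_extend[OF on] by auto
  then have "schmidt_decomposition UNIV l u' ket \<psi>"
    using psi[of u'] by (simp add: schmidt_decomposition_def l_nonneg orthonormal_family_ket)
  moreover have "\<psi> = complex_of_real (l 0) *s (u 0 \<otimes> ket 0) + complex_of_real (l 1) *s (u 1 \<otimes> ket 1)"
    using psi[of u] by (simp add: sum_UNIV_2)
  moreover have "\<forall>k. l k \<noteq> 0 \<longrightarrow> u' k = u k"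
    using u'(1) by blast
  ultimately show ?thesis
    unfolding l_def u_def Let_def by blast
qed

end
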